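(* The Gauss-Manin Lie algebra for local $\mathbb{P}^2$ is spanned by $$\mathsf{R}=\frac{z s_{33}^2}{Y_{111}}\frac{\partial}{\partial z}-s_{32}s_{33}^2\frac{\partial}{\partial s_{33}}+\frac{18z s_{33}^3}{Y_{111}}\frac{\partial}{\partial s_{32}},\qquad \mathsf{R}_{\mathfrak{g}_{33}}=s_{33}\frac{\partial}{\partial s_{33}}+s_{32}\frac{\partial}{\partial s_{32}},\qquad \mathsf{R}_{\mathfrak{g}_{32}}=\frac{1}{s_{33}}\frac{\partial}{\partial s_{32}},$$ where $Y_{111}=-\frac{1}{3(1-27z)}$, and it is isomorphic to $\mathfrak{sl}_2(\mathbb{C})$.
   Context: **Setting.** The mirror family of local $\mathbb{P}^2$ (the total space of the canonical bundle of $\mathbb{P}^2$) has fibres $X_z=\{uv+a_0+a_1t_1+a_2t_2+\frac{a_3}{t_1t_2}=0\}\subset\mathbb{C}^2\times(\mathbb{C}^* )^2$, $z=-a_1a_2a_3/a_0^3$. Put $\theta=z\frac{d}{dz}$. Let $\Omega$ be the holomorphic 3-form (the residue of $\frac{1}{F_{\pmb a}+uv}\frac{dt_1}{t_1}\wedge\frac{dt_2}{t_2}\wedge du\wedge dv$, where $F_{\pmb a}=a_0+a_1t_1+a_2t_2+\frac{a_3}{t_1t_2}$), whose periods are annihilated by the Picard-Fuchs operator $(\theta^2-3z(3\theta+1)(3\theta+2))\theta$. The frame $\omega=(\Omega,\nabla_\theta\Omega,Y_{111}^{-1}\nabla_\theta^2\Omega)^{\rm tr}$ of the bundle with fibres $H^3(X_z,\mathbb{C})$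 satisfies, for the Gauss-Manin connection $\nabla$, $$\nabla_\theta\omega=A_\theta\omega,\qquad A_\theta=\begin{pmatrix}0&1&0\\0&0&Y_{111}\\0&-18z&0\end{pmatrix}.$$ The changes of frame preserving the Hodge filtration ($F^3=\langle\Omega\rangle\subset F^2=\langle\Omega,\nabla_\theta\Omega\rangle\subset F^1=F^0=H^3$), the weight filtration ($W_3=W_4=W_5=\langle\nabla_\theta\Omega,\nabla_\theta^2\Omega\rangle\subset W_6=H^3$) and the pairing matrix $\begin{pmatrix}0&-1\\1&0\end{pmatrix}$ on $\mathrm{Gr}^W_3=W_3/W_2$, with first entry normalized to $1$, form the group $$\mathsf{G}=\left\{S=\begin{pmatrix}1&0&0\\0&s_{33}^{-1}&0\\0&s_{32}&s_{33}\end{pmatrix}\right\}.$$ The (local) moduli space $\mathsf{T}$ of enhanced varieties is a product of an open set in the $z$-space and a neighbourhood of $\mathrm{Id}$ in $\mathsf{G}$, with coordinates $(z,s_{32},s_{33})$; $\mathcal{O}_{\mathsf{T}}$ denotes the ring of regular functions on $\mathsf{T}$. On $\mathsf{T}$ one has the frame $\omega_{\mathsf{t}}=S\omega$ and $\nabla\omega_{\mathsf{t}}=(dS+SA_\theta\frac{dz}{z})S^{-1}\omega_{\mathsf{t}}$. **Gauss-Manin Lie algebra.** The modular vector field $\mathsf{R}$ is the unique vector field on $\mathsf{T}$ with $\nabla_{\mathsf{R}}\omega_{\mathsf{t}}=\begin{pmatrix}0&Y^{-1}(\mathsf{t})&0\\0&0&1\\0&0&0\end{pmatrix}\omega_{\mathsf{t}}$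 for some function $Y(\mathsf{t})$. For $\mathfrak{g}\in\mathrm{Lie}(\mathsf{G})$, $\mathsf{R}_{\mathfrak{g}}$ is the unique vector field on $\mathsf{T}$ with $\nabla_{\mathsf{R}_{\mathfrak{g}}}\omega_{\mathsf{t}}=\mathfrak{g}\omega_{\mathsf{t}}$. $\mathrm{Lie}(\mathsf{G})$ is generated by $\mathfrak{g}_{33}=\mathrm{diag}(0,-1,1)$ and $\mathfrak{g}_{32}$, the matrix whose only non-zero entry is a $1$ in row 3, column 2. The Gauss-Manin Lie algebra is defined as the $\mathcal{O}_{\mathsf{T}}$-module generated by the vector fields $\mathsf{R}_{\mathfrak{g}}$, $\mathfrak{g}\in\mathrm{Lie}(\mathsf{G})$, and the modular vector field(s); the bracket is the commutator of vector fields. *)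

theory Defs
  imports "HOL-Analysis.Analysis"
begin

text \<open>A point of the moduli space is \<open>p = (z, s\<^sub>3\<^sub>2, s\<^sub>3\<^sub>3)\<close>, so that \<open>p $ 1 = z\<close>, \<open>p $ 2 = s\<^sub>3\<^sub>2\<close>
  and \<open>p $ 3 = s\<^sub>3\<^sub>3\<close>.\<close>

definition S_mat :: "complex^3 \<Rightarrow> complex^3^3" where
  "S_mat p = vector [vector [1, 0, 0],
                     vector [0, inverse (p$3), 0],
                     vector [0, p$2, p$3]]"

definition group_G :: "(complex^3^3) set" where
  "group_G = {S_mat p | p. p$3 \<noteq> 0}"

text \<open>Tangent space of \<open>group_G\<close> at the identity: velocities of (complex) curves through \<open>Id\<close>.\<close>

definition lie_G :: "(complex^3^3) set" where
  "lie_G = {g. \<exists>\<gamma>::complex \<Rightarrow> complex^3^3. \<gamma> 0 = mat 1 \<and> (\<forall>\<^sub>F t in nhds 0. \<gamma> t \<in> group_G) \<and>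
      (\<forall>i j. ((\<lambda>t. \<gamma> t $ i $ j) has_field_derivative g $ i $ j) (at 0))}"

definition g33 :: "complex^3^3" where
  "g33 = vector [vector [0, 0, 0], vector [0, -1, 0], vector [0, 0, 1]]"

definition g32 :: "complex^3^3" where
  "g32 = vector [vector [0, 0, 0], vector [0, 0, 0], vector [0, 1, 0]]"

definition moduli_T :: "complex set \<Rightarrow> (complex^3^3) set \<Rightarrow> (complex^3) set" where
  "moduli_T U V = {p. p$1 \<in> U \<and> p$3 \<noteq> 0 \<and> S_mat p \<in> V}"

text \<open>Regular functions are the holomorphic functions on \<open>T\<close>, i.e. those with a complex-linear
  total derivative at each point. Functions and vector fields are extended by \<open>0\<close> outside \<open>T\<close>, so
  that equality in HOL is equality on \<open>T\<close>.\<close>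

definition regular_functions :: "(complex^3) set \<Rightarrow> (complex^3 \<Rightarrow> complex) set" where
  "regular_functions T = {f. (\<forall>p\<in>T. \<exists>D::complex^3. (f has_derivative (\<lambda>h. \<Sum>i\<in>UNIV. D$i * h$i)) (at p))
      \<and> (\<forall>p. p \<notin> T \<longrightarrow> f p = 0)}"

text \<open>\<open>X\<close> stands for \<open>X\<^sub>1 \<partial>/\<partial>z + X\<^sub>2 \<partial>/\<partial>s\<^sub>3\<^sub>2 + X\<^sub>3 \<partial>/\<partial>s\<^sub>3\<^sub>3\<close>, where \<open>X\<^sub>i p = X p $ i\<close>.\<close>

type_synonym vfield = "complex^3 \<Rightarrow> complex^3"

definition vector_fields :: "(complex^3) set \<Rightarrow> vfield set" where
  "vector_fields T = {X. \<forall>i. (\<lambda>p. X p $ i) \<in> regular_functions T}"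

definition on_T :: "(complex^3) set \<Rightarrow> vfield \<Rightarrow> vfield" where
  "on_T T X = (\<lambda>p. if p \<in> T then X p else 0)"

definition vf_apply :: "vfield \<Rightarrow> (complex^3 \<Rightarrow> complex) \<Rightarrow> complex^3 \<Rightarrow> complex" where
  "vf_apply X f p = frechet_derivative f (at p) (X p)"

text \<open>The commutator \<open>[X, Y]\<close> of vector fields; its \<open>i\<close>-th coefficient is its value
  \<open>X (Y x\<^sub>i) - Y (X x\<^sub>i)\<close> on the \<open>i\<close>-th coordinate function.\<close>

definition vf_bracket :: "(complex^3) set \<Rightarrow> vfield \<Rightarrow> vfield \<Rightarrow> vfield" where
  "vf_bracket T X Y =
     on_T T (\<lambda>p. \<chi> i. vf_apply X (\<lambda>q. Y q $ i) p - vf_apply Y (\<lambda>q. X q $ i) p)"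

definition Y111 :: "complex \<Rightarrow> complex" where
  "Y111 z = - 1 / (3 * (1 - 27 * z))"

definition A_theta :: "complex \<Rightarrow> complex^3^3" where
  "A_theta z = vector [vector [0, 1, 0],
                       vector [0, 0, Y111 z],
                       vector [0, -18 * z, 0]]"

text \<open>A section \<open>\<Sigma>\<^sub>i \<sigma>\<^sub>i \<omega>\<^sub>i\<close> of the pulled-back bundle is given by the row vector \<open>\<sigma>\<close> of its
  coefficients in the frame \<open>\<omega>\<close>. The formula is the Leibniz rule together with
  \<open>\<nabla>\<^sub>X \<omega> = (dz(X) / z) A\<^sub>\<theta> \<omega>\<close>. In particular the \<open>i\<close>-th element of the frame
  \<open>\<omega>\<^sub>t = S \<omega>\<close> is the \<open>i\<close>-th row of \<open>S\<close>.\<close>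

definition gm_conn :: "vfield \<Rightarrow> (complex^3 \<Rightarrow> complex^3) \<Rightarrow> complex^3 \<Rightarrow> complex^3" where
  "gm_conn X \<sigma> p = (\<chi> j. vf_apply X (\<lambda>q. \<sigma> q $ j) p) + (X p $ 1 / p $ 1) *s (\<sigma> p v* A_theta (p $ 1))"

definition omega_t :: "3 \<Rightarrow> complex^3 \<Rightarrow> complex^3" where
  "omega_t i p = S_mat p $ i"

text \<open>\<open>\<nabla>\<^sub>X \<omega>\<^sub>t = M \<omega>\<^sub>t\<close> on \<open>T\<close>.\<close>

definition conn_matrix :: "(complex^3) set \<Rightarrow> vfield \<Rightarrow> (complex^3 \<Rightarrow> complex^3^3) \<Rightarrow> bool" where
  "conn_matrix T X M \<longleftrightarrow>
     (\<forall>p\<in>T. \<forall>i. gm_conn X (omega_t i) p = (\<Sum>j\<in>UNIV. M p $ i $ j *s omega_t j p))"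

definition is_modular :: "(complex^3) set \<Rightarrow> vfield \<Rightarrow> bool" where
  "is_modular T X \<longleftrightarrow> X \<in> vector_fields T \<and>
     (\<exists>Y\<in>regular_functions T. (\<forall>p\<in>T. Y p \<noteq> 0) \<and>
        conn_matrix T X (\<lambda>p. vector [vector [0, inverse (Y p), 0],
                                     vector [0, 0, 1],
                                     vector [0, 0, 0]]))"

definition is_R :: "(complex^3) set \<Rightarrow> complex^3^3 \<Rightarrow> vfield \<Rightarrow> bool" where
  "is_R T g X \<longleftrightarrow> X \<in> vector_fields T \<and> conn_matrix T X (\<lambda>_. g)"

inductive_set span_over :: "(complex^3 \<Rightarrow> complex) set \<Rightarrow> vfield set \<Rightarrow> vfield set"
  for K B where
    zero: "(\<lambda>_. 0) \<in> span_over K B"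
  | add: "f \<in> K \<Longrightarrow> X \<in> B \<Longrightarrow> Y \<in> span_over K B \<Longrightarrow> (\<lambda>p. f p *s X p + Y p) \<in> span_over K B"

definition constants :: "(complex^3 \<Rightarrow> complex) set" where
  "constants = {(\<lambda>_. c) | c. True}"

definition gm_generators :: "(complex^3) set \<Rightarrow> vfield set" where
  "gm_generators T = {X. is_modular T X} \<union> {X. \<exists>g\<in>lie_G. is_R T g X}"

definition gm_lie_algebra :: "(complex^3) set \<Rightarrow> vfield set" where
  "gm_lie_algebra T = span_over (regular_functions T) (gm_generators T)"

definition sl2 :: "(complex^2^2) set" where
  "sl2 = {A. trace A = 0}"

definition sl2_iso :: "(complex^3) set \<Rightarrow> (complex^2^2 \<Rightarrow> vfield) \<Rightarrow> vfield set \<Rightarrow> bool" where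
  "sl2_iso T \<phi> L \<longleftrightarrow> bij_betw \<phi> sl2 L \<and>
     (\<forall>A\<in>sl2. \<forall>B\<in>sl2. \<phi> (A + B) = (\<lambda>p. \<phi> A p + \<phi> B p)) \<and>
     (\<forall>c. \<forall>A\<in>sl2. \<phi> (\<chi> i. c *s A $ i) = (\<lambda>p. c *s \<phi> A p)) \<and>
     (\<forall>A\<in>sl2. \<forall>B\<in>sl2. \<phi> (A ** B - B ** A) = vf_bracket T (\<phi> A) (\<phi> B))"

definition R_modular :: "(complex^3) set \<Rightarrow> vfield" where
  "R_modular T = on_T T (\<lambda>p. let z = p$1; s32 = p$2; s33 = p$3 in
     vector [z * s33^2 / Y111 z, 18 * z * s33^3 / Y111 z, - s32 * s33^2])"

definition R_g33 :: "(complex^3) set \<Rightarrow> vfield" where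
  "R_g33 T = on_T T (\<lambda>p. let s32 = p$2; s33 = p$3 in vector [0, s32, s33])"

definition R_g32 :: "(complex^3) set \<Rightarrow> vfield" where
  "R_g32 T = on_T T (\<lambda>p. let s33 = p$3 in vector [0, 1 / s33, 0])"

end

theory Submission
  imports Defs "HOL-Complex_Analysis.Cauchy_Integral_Formula"
begin

text \<open>Comparing the entries of \<open>\<nabla>\<^sub>X \<omega>\<^sub>t = M \<omega>\<^sub>t\<close> determines the three coefficients of \<open>X\<close>, which gives the
  formulas for \<open>R\<close>, \<open>R\<^sub>g\<^sub>3\<^sub>3\<close> and \<open>R\<^sub>g\<^sub>3\<^sub>2\<close>. These three fields are pointwise independent, so over the regular
  functions they span all holomorphic vector fields. Closure of that module under the commutator
  amounts to partial derivatives of regular functions being regular: by Cauchy's formula in one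
  variable they are circle integrals of the function, which can be differentiated under the
  integral sign once the same formula has shown that the gradient is continuous. Over the constants,
  \<open>[R\<^sub>g\<^sub>3\<^sub>3, R] = 2 R\<close>, \<open>[R\<^sub>g\<^sub>3\<^sub>3, R\<^sub>g\<^sub>3\<^sub>2] = - 2 R\<^sub>g\<^sub>3\<^sub>2\<close> and \<open>[R, R\<^sub>g\<^sub>3\<^sub>2] = R\<^sub>g\<^sub>3\<^sub>3\<close> are the \<open>sl\<^sub>2\<close> relations.\<close>

subsection \<open>Holomorphic functions of several variables\<close>

text \<open>On \<open>complex^'n\<close> the predicate \<open>has_derivative\<close> asks only for
  real linearity; the complex coefficients \<open>D\<close> force complex linearity and are the
  complex partial derivatives.\<close>

definition has_gradient :: "(complex^'n \<Rightarrow> complex) \<Rightarrow> complex^'n \<Rightarrow> complex^'n \<Rightarrow> bool" where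
  "has_gradient f D p \<longleftrightarrow> (f has_derivative (\<lambda>h. \<Sum>i\<in>UNIV. D $ i * h $ i)) (at p)"

lemma norm_axis: "norm (axis i (w::complex) :: complex^'n) = norm w"
  by (simp add: norm_vec_def L2_set_def axis_def if_distrib[where f = norm] if_distrib[where f = "\<lambda>x. x^2"]
      sum.delta cong: if_cong)

lemma bounded_linear_axis: "bounded_linear (axis i :: complex \<Rightarrow> complex^'n)"
  by (rule bounded_linear_intro[where K = 1])
     (simp_all add: norm_axis, simp_all add: axis_def vec_eq_iff)

lemma sum_mult_axis: "(\<Sum>j\<in>UNIV. D $ j * axis i (w::complex) $ j) = D $ i * w"
  by (simp add: axis_def if_distrib sum.delta cong: if_cong)

text \<open>Chain rule along the complex line through \<open>q\<close> in direction
  \<open>i\<close>; it makes one-variable Cauchy theory available.\<close>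

lemma has_gradient_slice:
  assumes "has_gradient f D (q + axis i w)"
  shows "((\<lambda>w. f (q + axis i w)) has_field_derivative D $ i) (at w)"
proof -
  have "((\<lambda>w. q + axis i w) has_derivative axis i) (at w)"
    using bounded_linear_imp_has_derivative[OF bounded_linear_axis]
    by (auto intro!: derivative_eq_intros)
  from has_derivative_compose[OF this assms[unfolded has_gradient_def]]
  show ?thesis
    by (simp add: has_field_derivative_def sum_mult_axis)
qed

lemma has_gradient_continuous_on:
  assumes "\<And>p. p \<in> T \<Longrightarrow> has_gradient f (D p) p"
  shows "continuous_on T f"
  using assms unfolding has_gradient_def
  by (meson continuous_at_imp_continuous_on has_derivative_continuous)

section \<open>Cauchy's formula for partial derivatives\<close>

lemma circlepath_0_nz:
  assumes "\<rho> > 0"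
  shows "norm (circlepath 0 \<rho> t) = \<rho>" "circlepath 0 \<rho> t \<noteq> 0"
  using assms by (simp_all add: circlepath norm_mult)

text \<open>Cauchy's formula for the derivative at the centre of the slice disc. The velocity at a
  point \<open>u\<close> of the circle is \<open>2 * pi * \<i> * u\<close>, which cancels the
  prefactor and one \<open>u\<close> of \<open>u^2\<close>. Only values of \<open>f\<close> remain
  on the right, so regularity of \<open>f\<close> passes to its partials.\<close>

lemma gradient_cauchy:
  assumes f: "\<And>w. norm w \<le> \<rho> \<Longrightarrow> has_gradient f (D (q + axis i w)) (q + axis i w)" and "\<rho> > 0"
  shows "D q $ i = integral {0..1}
    (\<lambda>t. f (q + axis i (circlepath 0 \<rho> t)) / circlepath 0 \<rho> t)"
proof -
  define g where "g = (\<lambda>w. f (q + axis i w))"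
  have d: "(g has_field_derivative D (q + axis i w) $ i) (at w)" if "norm w \<le> \<rho>" for w
    unfolding g_def by (rule has_gradient_slice[OF f[OF that]])
  have c: "continuous_on (cball 0 \<rho>) g"
    using d by (auto intro!: continuous_at_imp_continuous_on DERIV_isCont)
  have h: "g holomorphic_on ball 0 \<rho>"
    using d by (force simp: holomorphic_on_open)
  have "deriv g 0 = D q $ i"
    using d[of 0] \<open>\<rho> > 0\<close> by (simp add: DERIV_imp_deriv axis_def zero_vec_def[symmetric] cong: if_cong)
  then have "D q $ i = contour_integral (circlepath 0 \<rho>) (\<lambda>u. g u / u^2) / (2 * pi * \<i>)"
    using Cauchy_contour_integral_circlepath_2[OF c h, of 0] \<open>\<rho> > 0\<close> by simp
  also have "\<dots> = integral {0..1} (\<lambda>t. g (circlepath 0 \<rho> t) / circlepath 0 \<rho> t * (2 * pi * \<i>)) / (2 * pi * \<i>)"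
  proof -
    have v: "vector_derivative (circlepath 0 \<rho>) (at t) = 2 * pi * \<i> * circlepath 0 \<rho> t" for t
      by (simp only: vector_derivative_circlepath) (simp add: circlepath)
    show ?thesis
      unfolding contour_integral_integral v
      using circlepath_0_nz[OF \<open>\<rho> > 0\<close>]
      by (intro arg_cong2[where f="(/)"] integral_cong) (simp_all add: power2_eq_square)
  qed
  also have "\<dots> = integral {0..1} (\<lambda>t. g (circlepath 0 \<rho> t) / circlepath 0 \<rho> t)"
    by (subst integral_mult_left) simp
  finally show ?thesis by (simp add: g_def)
qed

text \<open>Halving the radius of a ball inside \<open>T\<close> leaves room for moving both the
  base point and the slice variable, with one \<open>\<rho>\<close> for all \<open>q\<close> near
  \<open>p\<close> and all directions.\<close>

lemma axis_polydisc:
  fixes p :: "complex^'n"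
  assumes "open T" "p \<in> T"
  obtains \<rho> where "\<rho> > 0"
    "\<And>q w j. q \<in> ball p \<rho> \<Longrightarrow> norm w \<le> \<rho> \<Longrightarrow> q + axis j w \<in> T"
proof -
  obtain e where e: "e > 0" "cball p e \<subseteq> T"
    using assms open_contains_cball by blast
  have "q + axis j w \<in> T" if "q \<in> ball p (e/2)" "norm w \<le> e/2" for q j w
  proof -
    have "dist p (q + axis j w) \<le> dist p q + norm w"
      using dist_triangle[of p "q + axis j w" q] by (simp add: dist_norm norm_axis)
    then show ?thesis using that e by auto
  qed
  then show thesis using e(1) by (intro that[of "e/2"]) auto
qed

text \<open>Parametric integrals require joint continuity in base point and parameter.
  \<open>F\<close> is general because it stands for \<open>f\<close> as well as for its
  partials.\<close>

lemma continuous_cauchy_kernel: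
  fixes F :: "complex^'n \<Rightarrow> complex"
  assumes F: "continuous_on T F" and "\<rho> > 0"
    and S: "\<And>q w. q \<in> S \<Longrightarrow> norm w \<le> \<rho> \<Longrightarrow> q + axis i w \<in> T"
  shows "continuous_on (S \<times> cbox 0 1)
    (\<lambda>(q, t). F (q + axis i (circlepath 0 \<rho> t)) / circlepath 0 \<rho> t)"
proof -
  have c: "continuous_on A (circlepath 0 \<rho>)" for A
    unfolding circlepath by (intro continuous_intros)
  have m: "continuous_on (S \<times> cbox 0 1) (\<lambda>x. fst x + axis i (circlepath 0 \<rho> (snd x)))"
    by (intro continuous_intros continuous_on_compose2[OF linear_continuous_on[OF bounded_linear_axis]]
          continuous_on_compose2[OF c]) auto
  show ?thesis
    unfolding split_beta
    by (intro continuous_intros continuous_on_compose2[OF F m] continuous_on_compose2[OF c])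
       (use S circlepath_0_nz[OF \<open>\<rho> > 0\<close>] in auto)
qed

text \<open>Near each point \<open>gradient_cauchy\<close> writes the partial as an integral of a
  jointly continuous kernel over a compact interval, hence continuous in the base point.\<close>

lemma continuous_on_gradient:
  fixes f :: "complex^'n \<Rightarrow> complex"
  assumes T: "open T" and f: "\<And>p. p \<in> T \<Longrightarrow> has_gradient f (D p) p"
  shows "continuous_on T (\<lambda>q. D q $ i)"
proof (intro continuous_at_imp_continuous_on ballI)
  fix p assume "p \<in> T"
  then obtain \<rho> where \<rho>: "\<rho> > 0"
    "\<And>q w j. q \<in> ball p \<rho> \<Longrightarrow> norm w \<le> \<rho> \<Longrightarrow> q + axis j w \<in> T"
    using axis_polydisc[OF T] by blast
  have "continuous_on (ball p \<rho>)
    (\<lambda>q. integral (cbox 0 1) (\<lambda>t. f (q + axis i (circlepath 0 \<rho> t)) / circlepath 0 \<rho> t))"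
    by (intro integral_continuous_on_param continuous_cauchy_kernel[OF has_gradient_continuous_on[OF f]])
       (use \<rho> in auto)
  then have "continuous_on (ball p \<rho>) (\<lambda>q. D q $ i)"
    by (rule continuous_on_eq) (use \<rho> in \<open>auto intro!: gradient_cauchy[symmetric] f\<close>)
  then show "isCont (\<lambda>q. D q $ i) p"
    using \<rho>(1) by (simp add: continuous_on_eq_continuous_at)
qed

text \<open>Differentiates the Cauchy integral under the integral sign. The differentiated kernel
  contains the gradient of \<open>f\<close> on the circle, whose continuity is
  \<open>continuous_on_gradient\<close>.\<close>

lemma has_gradient_partial:
  fixes f :: "complex^'n \<Rightarrow> complex"
  assumes T: "open T" and f: "\<And>p. p \<in> T \<Longrightarrow> has_gradient f (D p) p" and p: "p \<in> T"
  shows "\<exists>E. has_gradient (\<lambda>q. D q $ i) E p"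
proof -
  obtain \<rho> where \<rho>: "\<rho> > 0"
    "\<And>q w j. q \<in> ball p \<rho> \<Longrightarrow> norm w \<le> \<rho> \<Longrightarrow> q + axis j w \<in> T"
    using axis_polydisc[OF T p] by blast
  define c where "c = circlepath 0 \<rho>"
  note nc = circlepath_0_nz[OF \<rho>(1), folded c_def]
  define k where "k = (\<lambda>q t. f (q + axis i (c t)) / c t)"
  define E where "E = (\<lambda>q t. \<chi> j. D (q + axis i (c t)) $ j / c t)"
  \<comment> \<open>\<open>leibniz_rule\<close> takes the derivative of the kernel as a continuous
    family of bounded linear maps, so the gradient \<open>E\<close> is packaged as an
    operator.\<close>
  define K where "K = (\<lambda>q t. Blinfun (\<lambda>h. \<Sum>j\<in>UNIV. E q t $ j * h $ j))"
  have bl: "bounded_linear (\<lambda>h::complex^'n. \<Sum>j\<in>UNIV. E q t $ j * h $ j)" for q t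
    by (intro bounded_linear_intros bounded_linear_compose[OF bounded_linear_mult_right] bounded_linear_vec_nth)
  have K: "blinfun_apply (K q t) = (\<lambda>h. \<Sum>j\<in>UNIV. E q t $ j * h $ j)" for q t
    unfolding K_def by (rule bounded_linear_Blinfun_apply[OF bl])
  have der: "((\<lambda>q. k q t) has_derivative blinfun_apply (K q t)) (at q within ball p \<rho>)"
    if "q \<in> ball p \<rho>" for q t
  proof -
    have g: "has_gradient f (D (q + axis i (c t))) (q + axis i (c t))"
      by (intro f \<rho>(2) that) (simp add: nc)
    have "((\<lambda>q. q + axis i (c t)) has_derivative (\<lambda>h. h)) (at q)"
      by (auto intro!: derivative_eq_intros)
    from has_derivative_compose[OF this g[unfolded has_gradient_def]]
    have "((\<lambda>q. f (q + axis i (c t)) * inverse (c t)) has_derivative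
        (\<lambda>h. (\<Sum>j\<in>UNIV. D (q + axis i (c t)) $ j * h $ j) * inverse (c t))) (at q)"
      by (rule has_derivative_mult_left)
    moreover have "(\<Sum>j\<in>UNIV. D (q + axis i (c t)) $ j * h $ j) * inverse (c t)
        = (\<Sum>j\<in>UNIV. E q t $ j * h $ j)" for h
      unfolding sum_distrib_right by (intro sum.cong) (simp_all add: E_def divide_inverse)
    ultimately show ?thesis
      unfolding K k_def divide_inverse by (simp add: has_derivative_at_withinI)
  qed
  have contE: "continuous_on (ball p \<rho> \<times> cbox 0 1) (\<lambda>(q, t). E q t $ j)" for j
    using continuous_cauchy_kernel[OF continuous_on_gradient[OF T f] \<rho>(1), where S = "ball p \<rho>" and i = i]
    by (simp add: E_def c_def \<rho>(2))
  have contK: "continuous_on (ball p \<rho> \<times> cbox 0 1) (\<lambda>(q, t). K q t)"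
    unfolding split_beta
    by (rule continuous_on_blinfun_componentwise, unfold K)
       (intro continuous_intros contE[unfolded split_beta])
  have slice: "continuous_on (cbox 0 1) (\<lambda>t. G q t)"
    if "continuous_on (ball p \<rho> \<times> cbox 0 1) (\<lambda>(q, t). G q t)" "q \<in> ball p \<rho>"
    for G :: "complex^'n \<Rightarrow> real \<Rightarrow> 'c::topological_space" and q
  proof -
    have "continuous_on (cbox 0 1) (\<lambda>t::real. (q, t))"
      by (intro continuous_intros)
    moreover have "(\<lambda>t. (q, t)) ` cbox 0 1 \<subseteq> ball p \<rho> \<times> cbox 0 1"
      using that(2) by auto
    ultimately show ?thesis
      using continuous_on_compose2[OF that(1)] by fastforce
  qed
  have contk: "continuous_on (ball p \<rho> \<times> cbox 0 1) (\<lambda>(q, t). k q t)"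
    using continuous_cauchy_kernel[OF has_gradient_continuous_on[OF f] \<rho>(1), where S = "ball p \<rho>" and i = i]
    by (simp add: k_def c_def \<rho>(2))
  have pin: "p \<in> ball p \<rho>" using \<rho>(1) by simp
  have "((\<lambda>q. integral (cbox 0 1) (k q)) has_derivative integral (cbox 0 1) (K p)) (at p within ball p \<rho>)"
    by (intro leibniz_rule der integrable_continuous slice[OF contk] contK pin) auto
  \<comment> \<open>So far the integral of operators is only real-linear; moving evaluation at
    \<open>h\<close> inside the integral exhibits its complex coefficients.\<close>
  moreover have "blinfun_apply (integral (cbox 0 1) (K p))
      = (\<lambda>h. \<Sum>j\<in>UNIV. (\<chi> j. integral (cbox 0 1) (\<lambda>t. E p t $ j)) $ j * h $ j)"
  proof
    fix h
    have int: "(\<lambda>t. E p t $ j) integrable_on cbox 0 1" for j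
      by (intro integrable_continuous slice[OF contE pin])
    have "blinfun_apply (integral (cbox 0 1) (K p)) h = integral (cbox 0 1) (\<lambda>t. K p t h)"
      by (intro blinfun_apply_integral integrable_continuous slice[OF contK pin])
    also have "\<dots> = (\<Sum>j\<in>UNIV. integral (cbox 0 1) (\<lambda>t. E p t $ j * h $ j))"
      unfolding K using int by (intro integral_sum) (auto intro: integrable_on_mult_left)
    also have "\<dots> = (\<Sum>j\<in>UNIV. integral (cbox 0 1) (\<lambda>t. E p t $ j) * h $ j)"
      by (simp add: integral_mult_left)
    finally show "blinfun_apply (integral (cbox 0 1) (K p)) h
      = (\<Sum>j\<in>UNIV. (\<chi> j. integral (cbox 0 1) (\<lambda>t. E p t $ j)) $ j * h $ j)" by simp
  qed
  ultimately have "has_gradient (\<lambda>q. integral (cbox 0 1) (k q)) (\<chi> j. integral (cbox 0 1) (\<lambda>t. E p t $ j)) p"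
    unfolding has_gradient_def using pin by (simp add: at_within_open[OF _ open_ball])
  then have "has_gradient (\<lambda>q. D q $ i) (\<chi> j. integral (cbox 0 1) (\<lambda>t. E p t $ j)) p"
    unfolding has_gradient_def
    by (rule has_derivative_transform_within_open[OF _ open_ball pin])
       (use \<rho> in \<open>auto simp: k_def c_def intro!: gradient_cauchy[symmetric] f\<close>)
  then show ?thesis by blast
qed

section \<open>Calculus of gradients and complex differentiability\<close>

lemma has_gradient_const: "has_gradient (\<lambda>_. c) 0 p"
  by (simp add: has_gradient_def)

lemma has_gradient_nth: "has_gradient (\<lambda>p. p $ k) (axis k 1) p"
proof -
  have "(\<Sum>i\<in>UNIV. axis k (1::complex) $ i * h $ i) = h $ k" for h
    using sum_mult_axis[of h k 1] by (simp add: mult.commute)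
  then show ?thesis
    unfolding has_gradient_def
    by (simp add: bounded_linear_imp_has_derivative bounded_linear_vec_nth)
qed

lemma has_gradient_add:
  assumes "has_gradient f D p" "has_gradient g E p"
  shows "has_gradient (\<lambda>p. f p + g p) (D + E) p"
  using has_derivative_add[OF assms[unfolded has_gradient_def]]
  by (simp add: has_gradient_def distrib_right sum.distrib)

lemma has_gradient_mult:
  assumes "has_gradient f D p" "has_gradient g E p"
  shows "has_gradient (\<lambda>p. f p * g p) (f p *s E + g p *s D) p"
  using has_derivative_mult[OF assms[unfolded has_gradient_def]]
  by (simp add: has_gradient_def sum.distrib sum_distrib_left algebra_simps)

lemma has_gradient_inverse:
  assumes "has_gradient f D p" "f p \<noteq> 0"
  shows "has_gradient (\<lambda>p. inverse (f p)) ((- (inverse (f p) ^ 2)) *s D) p"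
  using Deriv.has_derivative_inverse[OF assms(2) assms(1)[unfolded has_gradient_def]]
  by (simp add: has_gradient_def sum_distrib_left sum_distrib_right sum_negf power2_eq_square mult_ac)

lemma has_gradient_transform:
  assumes "has_gradient f D p" "open T" "p \<in> T" "\<And>q. q \<in> T \<Longrightarrow> f q = g q"
  shows "has_gradient g D p"
  using assms has_derivative_transform_within_open unfolding has_gradient_def by blast

text \<open>\<open>frechet_derivative\<close> is a chosen derivative; by uniqueness any known
  gradient computes it.\<close>

lemma vf_apply_eq:
  assumes "has_gradient f D p"
  shows "vf_apply X f p = (\<Sum>i\<in>UNIV. D $ i * X p $ i)"
  using frechet_derivative_at[OF assms[unfolded has_gradient_def]]
  unfolding vf_apply_def by metis

text \<open>Complex differentiability at the single point \<open>p\<close>; imposed at all points of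
  an open set it is holomorphy.\<close>

definition holomorphic_at :: "(complex^'n \<Rightarrow> complex) \<Rightarrow> complex^'n \<Rightarrow> bool" where
  "holomorphic_at f p \<longleftrightarrow> (\<exists>D. has_gradient f D p)"

lemma holomorphic_at_const: "holomorphic_at (\<lambda>_. c) p"
  unfolding holomorphic_at_def using has_gradient_const by blast

lemma holomorphic_at_nth: "holomorphic_at (\<lambda>p. p $ k) p"
  unfolding holomorphic_at_def using has_gradient_nth by blast

lemma holomorphic_at_add:
  "holomorphic_at f p \<Longrightarrow> holomorphic_at g p \<Longrightarrow> holomorphic_at (\<lambda>p. f p + g p) p"
  unfolding holomorphic_at_def using has_gradient_add by blast

lemma holomorphic_at_mult:
  "holomorphic_at f p \<Longrightarrow> holomorphic_at g p \<Longrightarrow> holomorphic_at (\<lambda>p. f p * g p) p"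
  unfolding holomorphic_at_def using has_gradient_mult by blast

lemma holomorphic_at_minus:
  "holomorphic_at f p \<Longrightarrow> holomorphic_at (\<lambda>p. - f p) p"
  using holomorphic_at_mult[OF holomorphic_at_const[of "-1"]] by force

lemma holomorphic_at_diff:
  "holomorphic_at f p \<Longrightarrow> holomorphic_at g p \<Longrightarrow> holomorphic_at (\<lambda>p. f p - g p) p"
  using holomorphic_at_add[OF _ holomorphic_at_minus] by force

lemma holomorphic_at_inverse:
  "holomorphic_at f p \<Longrightarrow> f p \<noteq> 0 \<Longrightarrow> holomorphic_at (\<lambda>p. inverse (f p)) p"
  unfolding holomorphic_at_def using has_gradient_inverse by blast

lemma holomorphic_at_divide:
  "holomorphic_at f p \<Longrightarrow> holomorphic_at g p \<Longrightarrow> g p \<noteq> 0 \<Longrightarrow> holomorphic_at (\<lambda>p. f p / g p) p"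
  unfolding divide_inverse by (intro holomorphic_at_mult holomorphic_at_inverse)

lemma holomorphic_at_power:
  "holomorphic_at f p \<Longrightarrow> holomorphic_at (\<lambda>p. f p ^ n) p"
  by (induction n) (simp_all add: holomorphic_at_const holomorphic_at_mult)

lemma holomorphic_at_sum:
  "(\<And>i. i \<in> I \<Longrightarrow> holomorphic_at (f i) p) \<Longrightarrow> holomorphic_at (\<lambda>p. \<Sum>i\<in>I. f i p) p"
  by (induction I rule: infinite_finite_induct)
     (simp_all add: holomorphic_at_const holomorphic_at_add)

lemmas holomorphic_at_intros =
  holomorphic_at_const holomorphic_at_nth holomorphic_at_add holomorphic_at_mult
  holomorphic_at_minus holomorphic_at_diff holomorphic_at_divide holomorphic_at_power
  holomorphic_at_inverse holomorphic_at_sum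

lemma holomorphic_at_transform:
  assumes "holomorphic_at f p" "open T" "p \<in> T" "\<And>q. q \<in> T \<Longrightarrow> f q = g q"
  shows "holomorphic_at g p"
  using assms has_gradient_transform unfolding holomorphic_at_def by blast

section \<open>Regular functions and vector fields on an open set\<close>

lemma regular_functions_iff:
  "f \<in> regular_functions T \<longleftrightarrow> (\<forall>p\<in>T. holomorphic_at f p) \<and> (\<forall>p. p \<notin> T \<longrightarrow> f p = 0)"
  by (simp add: regular_functions_def holomorphic_at_def has_gradient_def)

text \<open>A function cut off to 0 outside the open set \<open>T\<close> agrees with its formula
  \<open>g\<close> near each point of \<open>T\<close>.\<close>

lemma regular_functionsI:
  assumes "open T" "\<And>p. p \<in> T \<Longrightarrow> holomorphic_at g p"
    and "\<And>p. p \<in> T \<Longrightarrow> f p = g p" "\<And>p. p \<notin> T \<Longrightarrow> f p = 0"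
  shows "f \<in> regular_functions T"
  unfolding regular_functions_iff
  using assms holomorphic_at_transform[of g _ T f] by auto

lemma vf_eqI:
  assumes "X \<in> vector_fields T" "Y \<in> vector_fields T" "\<And>p. p \<in> T \<Longrightarrow> X p = Y p"
  shows "X = Y"
proof
  fix p
  show "X p = Y p"
    using assms by (cases "p \<in> T") (auto simp: vector_fields_def regular_functions_iff vec_eq_iff)
qed

text \<open>The coefficients of the bracket are sums of products of coefficients and their partials,
  and the partials are holomorphic by \<open>has_gradient_partial\<close>.\<close>

lemma vf_bracket_vector_field:
  assumes T: "open T" and X: "X \<in> vector_fields T" and Y: "Y \<in> vector_fields T"
  shows "vf_bracket T X Y \<in> vector_fields T"
proof -
  \<comment> \<open>The gradients are chosen on all of \<open>T\<close> at once, since they are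
    differentiated again as functions of the point.\<close>
  have grad: "\<exists>D. \<forall>p\<in>T. \<forall>i. has_gradient (\<lambda>q. Z q $ i) (D i p) p"
    if "Z \<in> vector_fields T" for Z
    using that unfolding vector_fields_def regular_functions_iff holomorphic_at_def mem_Collect_eq
    by metis
  obtain DX DY where D: "\<And>p i. p \<in> T \<Longrightarrow> has_gradient (\<lambda>q. X q $ i) (DX i p) p"
      "\<And>p i. p \<in> T \<Longrightarrow> has_gradient (\<lambda>q. Y q $ i) (DY i p) p"
    using grad[OF X] grad[OF Y] by blast
  have H: "holomorphic_at (\<lambda>q. DX i q $ j) p" "holomorphic_at (\<lambda>q. DY i q $ j) p"
      "holomorphic_at (\<lambda>q. X q $ j) p" "holomorphic_at (\<lambda>q. Y q $ j) p"
    if "p \<in> T" for p i j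
    unfolding holomorphic_at_def
    using has_gradient_partial[OF T D(1) that] has_gradient_partial[OF T D(2) that] D that by blast+
  show ?thesis
    unfolding vector_fields_def
  proof (intro CollectI allI)
    fix i
    show "(\<lambda>p. vf_bracket T X Y p $ i) \<in> regular_functions T"
      by (rule regular_functionsI[OF T, of "\<lambda>p. (\<Sum>j\<in>UNIV. DY i p $ j * X p $ j) - (\<Sum>j\<in>UNIV. DX i p $ j * Y p $ j)"])
         (auto simp: vf_bracket_def on_T_def vf_apply_eq[OF D(1)] vf_apply_eq[OF D(2)]
           intro!: holomorphic_at_intros H)
  qed
qed

subsection \<open>The Gauss-Manin Lie algebra\<close>

lemma span_over_mono: "X \<in> span_over K B \<Longrightarrow> B \<subseteq> B' \<Longrightarrow> X \<in> span_over K B'"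
  by (induction rule: span_over.induct) (auto intro: span_over.intros)

text \<open>Collecting terms uses only 0 and sums in \<open>K\<close>, so one normal form serves
  both regular functions and constants.\<close>

lemma span_over_three:
  assumes K0: "(\<lambda>_. 0) \<in> K" and Kadd: "\<And>f g. f \<in> K \<Longrightarrow> g \<in> K \<Longrightarrow> (\<lambda>p. f p + g p) \<in> K"
  shows "span_over K {A, B, C}
    = {X. \<exists>a\<in>K. \<exists>b\<in>K. \<exists>c\<in>K. X = (\<lambda>p. a p *s A p + b p *s B p + c p *s C p)}" (is "_ = ?R")
proof
  have mem: "X \<in> ?R"
    if "a \<in> K" "b \<in> K" "c \<in> K" "X = (\<lambda>p. a p *s A p + b p *s B p + c p *s C p)" for X a b c
    using that by blast
  show "span_over K {A, B, C} \<subseteq> ?R"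
  proof
    fix X assume "X \<in> span_over K {A, B, C}"
    then show "X \<in> ?R"
    proof induction
      case zero
      show ?case by (rule mem[OF K0 K0 K0]) simp
    next
      case (add f X Y)
      then obtain a b c where Y: "Y = (\<lambda>p. a p *s A p + b p *s B p + c p *s C p)"
        and K: "a \<in> K" "b \<in> K" "c \<in> K" by blast
      from add(2) consider "X = A" | "X = B" | "X = C" by blast
      then show ?case
      proof cases
        case 1
        show ?thesis
          by (rule mem[OF Kadd[OF add(1) K(1)] K(2,3)])
            (simp add: 1 Y fun_eq_iff vector_sadd_rdistrib add_ac)
      next
        case 2
        show ?thesis
          by (rule mem[OF K(1) Kadd[OF add(1) K(2)] K(3)])
            (simp add: 2 Y fun_eq_iff vector_sadd_rdistrib add_ac)
      next
        case 3
        show ?thesis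
          by (rule mem[OF K(1,2) Kadd[OF add(1) K(3)]])
            (simp add: 3 Y fun_eq_iff vector_sadd_rdistrib add_ac)
      qed
    qed
  qed
  show "?R \<subseteq> span_over K {A, B, C}"
  proof
    fix X assume "X \<in> ?R"
    then obtain a b c where X: "X = (\<lambda>p. a p *s A p + b p *s B p + c p *s C p)"
      and K: "a \<in> K" "b \<in> K" "c \<in> K" by blast
    have "(\<lambda>p. a p *s A p + (b p *s B p + (c p *s C p + 0))) \<in> span_over K {A, B, C}"
      using K by (intro span_over.add span_over.zero) auto
    then show "X \<in> span_over K {A, B, C}" by (simp add: X add.assoc)
  qed
qed

section \<open>The Lie algebra of the group\<close>

definition lie_mat :: "complex \<Rightarrow> complex \<Rightarrow> complex^3^3" where
  "lie_mat a b = vector [vector [0, 0, 0], vector [0, - a, 0], vector [0, b, a]]"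

text \<open>Entries constant on \<open>group_G\<close> have velocity 0, and the two varying diagonal
  entries, being inverse to each other, have opposite velocities at the identity. Conversely an
  explicit curve realizes each \<open>lie_mat a b\<close>.\<close>

lemma lie_G_eq: "lie_G = {lie_mat a b | a b. True}"
proof (intro equalityI subsetI)
  fix g assume "g \<in> lie_G"
  then obtain \<gamma> :: "complex \<Rightarrow> complex^3^3" where \<gamma>: "\<gamma> 0 = mat 1"
      and ev: "\<forall>\<^sub>F t in nhds 0. \<gamma> t \<in> group_G"
      and d: "\<And>i j. ((\<lambda>t. \<gamma> t $ i $ j) has_field_derivative g $ i $ j) (at 0)"
    unfolding lie_G_def by blast
  have const: "g $ i $ j = 0" if "\<And>A. A \<in> group_G \<Longrightarrow> A $ i $ j = c" for i j c
  proof -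
    have "\<forall>\<^sub>F t in nhds 0. \<gamma> t $ i $ j = c"
      using ev by eventually_elim (rule that)
    then have "((\<lambda>t. c) has_field_derivative g $ i $ j) (at 0)"
      using d[of i j] by (subst (asm) DERIV_cong_ev[OF refl _ refl]) auto
    then show ?thesis using DERIV_const DERIV_unique by blast
  qed
  \<comment> \<open>Both factors equal 1 at \<open>t = 0\<close>, so the product rule yields the sum
    of the diagonal velocities.\<close>
  have "((\<lambda>t. \<gamma> t $ 2 $ 2 * \<gamma> t $ 3 $ 3) has_field_derivative g $ 2 $ 2 * 1 + g $ 3 $ 3 * 1) (at 0)"
    using DERIV_mult[OF d[of 2 2] d[of 3 3]] by (simp add: \<gamma> mat_def)
  moreover have "\<forall>\<^sub>F t in nhds 0. \<gamma> t $ 2 $ 2 * \<gamma> t $ 3 $ 3 = 1"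
    using ev by eventually_elim (auto simp: group_G_def S_mat_def)
  ultimately have "((\<lambda>t. 1) has_field_derivative g $ 2 $ 2 * 1 + g $ 3 $ 3 * 1) (at 0)"
    by (subst (asm) DERIV_cong_ev[OF refl _ refl]) auto
  then have "g $ 2 $ 2 + g $ 3 $ 3 = 0"
    using DERIV_unique[OF _ DERIV_const] by force
  then have "g $ 2 $ 2 = - g $ 3 $ 3" by (simp add: eq_neg_iff_add_eq_0)
  moreover have "g $ 1 $ 1 = 0" "g $ 1 $ 2 = 0" "g $ 1 $ 3 = 0" "g $ 2 $ 1 = 0" "g $ 2 $ 3 = 0" "g $ 3 $ 1 = 0"
    by (rule const, force simp: group_G_def S_mat_def)+
  ultimately have "g = lie_mat (g $ 3 $ 3) (g $ 3 $ 2)"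
    by (simp add: lie_mat_def vec_eq_iff forall_3)
  then show "g \<in> {lie_mat a b | a b. True}" by blast
next
  fix g assume "g \<in> {lie_mat a b | a b. True}"
  then obtain a b where g: "g = lie_mat a b" by blast
  \<comment> \<open>The (2,2) entry is the inverse of \<open>1 + a * t\<close>, with velocity
    \<open>- a\<close>; the curve stays in \<open>group_G\<close> for \<open>t\<close> near
    0.\<close>
  define \<gamma> where "\<gamma> = (\<lambda>t. S_mat (vector [0, b * t, 1 + a * t]))"
  have "((\<lambda>t. 1 + a * t) \<longlongrightarrow> 1 + a * 0) (nhds 0)"
    by (intro tendsto_intros filterlim_ident)
  then have "\<forall>\<^sub>F t in nhds 0. 1 + a * t \<noteq> 0"
    by (rule tendsto_imp_eventually_ne) simp
  then have "\<forall>\<^sub>F t in nhds 0. \<gamma> t \<in> group_G"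
    by eventually_elim (auto simp: \<gamma>_def group_G_def)
  moreover have "\<gamma> 0 = mat 1"
    by (simp add: \<gamma>_def S_mat_def mat_def vec_eq_iff forall_3)
  moreover have "((\<lambda>t. \<gamma> t $ i $ j) has_field_derivative g $ i $ j) (at 0)" for i j
    using exhaust_3[of i] exhaust_3[of j]
    by (auto simp: \<gamma>_def S_mat_def g lie_mat_def intro!: derivative_eq_intros)
  ultimately show "g \<in> lie_G" unfolding lie_G_def by blast
qed

lemma g33_eq: "g33 = lie_mat 1 0" and g32_eq: "g32 = lie_mat 0 1"
  by (simp_all add: g33_def g32_def lie_mat_def)

section \<open>The connection and the vector fields in coordinates\<close>

text \<open>Rows of \<open>dS + S A dz/z\<close> evaluated on \<open>X\<close>, in the frame
  \<open>\<omega>\<close>. In row 3 the \<open>z\<close> of the entry \<open>-18 * z\<close> cancels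
  the division by \<open>z\<close>.\<close>

lemma gm_conn_omega_t:
  assumes "p $ 1 \<noteq> 0" "p $ 3 \<noteq> 0"
  shows "gm_conn X (omega_t 1) p = vector [0, X p $ 1 / p $ 1, 0]"
    "gm_conn X (omega_t 2) p =
      vector [0, - X p $ 3 / (p $ 3)^2, X p $ 1 / p $ 1 * Y111 (p $ 1) / p $ 3]"
    "gm_conn X (omega_t 3) p =
      vector [0, X p $ 2 - 18 * p $ 3 * X p $ 1, X p $ 3 + X p $ 1 / p $ 1 * Y111 (p $ 1) * p $ 2]"
proof -
  have c: "vf_apply X (\<lambda>_. k) p = 0" for k
    by (simp add: vf_apply_eq[OF has_gradient_const])
  have n: "vf_apply X (\<lambda>q. q $ k) p = X p $ k" for k
    using sum_mult_axis[of "X p" k 1] by (simp add: vf_apply_eq[OF has_gradient_nth] mult.commute)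
  have i: "vf_apply X (\<lambda>q. inverse (q $ 3)) p = - X p $ 3 / (p $ 3)^2"
    using n[of 3, unfolded vf_apply_eq[OF has_gradient_nth]] assms
    by (simp add: vf_apply_eq[OF has_gradient_inverse[OF has_gradient_nth]] mult.assoc
        sum_negf sum_distrib_left[symmetric] divide_inverse power_inverse)
  note simps = gm_conn_def omega_t_def S_mat_def vec_eq_iff forall_3 c n i
    vector_matrix_mult_def sum_3 A_theta_def
  show "gm_conn X (omega_t 1) p = vector [0, X p $ 1 / p $ 1, 0]"
    by (simp add: simps)
  show "gm_conn X (omega_t 2) p =
      vector [0, - X p $ 3 / (p $ 3)^2, X p $ 1 / p $ 1 * Y111 (p $ 1) / p $ 3]"
    by (simp add: simps divide_inverse)
  show "gm_conn X (omega_t 3) p =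
      vector [0, X p $ 2 - 18 * p $ 3 * X p $ 1, X p $ 3 + X p $ 1 / p $ 1 * Y111 (p $ 1) * p $ 2]"
    using assms by (simp add: simps field_simps)
qed

text \<open>At \<open>z = 1/27\<close> both sides are 0 by the convention for division by 0, so the
  identity holds for every \<open>z\<close>.\<close>

lemma inverse_Y111: "inverse (Y111 z) = - 3 * (1 - 27 * z)"
  by (simp add: Y111_def)

lemma R_modular_eq:
  "R_modular T = on_T T (\<lambda>p. vector [-3 * p$1 * (1 - 27 * p$1) * (p$3)^2,
     -54 * p$1 * (1 - 27 * p$1) * (p$3)^3, - p$2 * (p$3)^2])"
  by (simp add: R_modular_def Let_def divide_inverse inverse_Y111 algebra_simps)

lemma vector_fields_on_T:
  assumes "open T" "\<And>p i. p \<in> T \<Longrightarrow> holomorphic_at (\<lambda>p. X p $ i) p"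
  shows "on_T T X \<in> vector_fields T"
  unfolding vector_fields_def
  by (auto simp: on_T_def intro!: regular_functionsI[OF assms(1), of "\<lambda>p. X p $ _"] assms(2))

text \<open>The functions \<open>z\<close>, \<open>1 - 27 * z\<close> and \<open>s33\<close> are the
  ones that get inverted when solving for coefficients; a point of \<open>T\<close> is needed to
  read off constants.\<close>

locale moduli =
  fixes T :: "(complex^3) set"
  assumes open_T: "open T" and nonempty_T: "T \<noteq> {}"
    and T_nz: "\<And>p. p \<in> T \<Longrightarrow> p $ 1 \<noteq> 0" "\<And>p. p \<in> T \<Longrightarrow> 1 - 27 * p $ 1 \<noteq> 0" "\<And>p. p \<in> T \<Longrightarrow> p $ 3 \<noteq> 0"
begin

definition comb :: "complex \<Rightarrow> complex \<Rightarrow> complex \<Rightarrow> vfield" where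
  "comb a b c = (\<lambda>p. a *s R_modular T p + b *s R_g33 T p + c *s R_g32 T p)"

lemma comb_eq:
  "comb a b c = on_T T (\<lambda>p. vector [-3 * a * p$1 * (1 - 27 * p$1) * (p$3)^2,
     -54 * a * p$1 * (1 - 27 * p$1) * (p$3)^3 + b * p$2 + c / p$3, - a * p$2 * (p$3)^2 + b * p$3])"
  by (auto simp: comb_def R_modular_eq R_g33_def R_g32_def on_T_def Let_def fun_eq_iff vec_eq_iff
      forall_3)

lemma comb_vector_field: "comb a b c \<in> vector_fields T"
proof -
  have "holomorphic_at (\<lambda>p. vector [-3 * a * p$1 * (1 - 27 * p$1) * (p$3)^2,
     -54 * a * p$1 * (1 - 27 * p$1) * (p$3)^3 + b * p$2 + c / p$3, - a * p$2 * (p$3)^2 + b * p$3] $ i) p"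
    if "p \<in> T" for p :: "complex^3" and i :: 3
    using exhaust_3[of i] T_nz[OF that]
    by (auto intro!: holomorphic_at_intros)
  then show ?thesis unfolding comb_eq by (intro vector_fields_on_T open_T)
qed

lemma comb_basis: "R_modular T = comb 1 0 0" "R_g33 T = comb 0 1 0" "R_g32 T = comb 0 0 1"
  by (simp_all add: comb_def fun_eq_iff)

lemmas basis_vector_fields = comb_vector_field[of 1 0 0, folded comb_basis(1)]
  comb_vector_field[of 0 1 0, folded comb_basis(2)] comb_vector_field[of 0 0 1, folded comb_basis(3)]

section \<open>Vector fields determined by their connection matrices\<close>

text \<open>Both sides are compared in the frame \<open>\<omega>\<close>, which multiplies the
  matrix by \<open>S_mat p\<close>. The shape covers the modular matrix and \<open>lie_mat\<close>
  alike; the five equations are the entries that are not trivially 0.\<close>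

lemma conn_matrix_iff:
  "conn_matrix T X (\<lambda>p. vector [vector [0, m p, 0], vector [0, a p, b p], vector [0, c p, d p]]) \<longleftrightarrow>
   (\<forall>p\<in>T. X p $ 1 / p $ 1 = m p / p $ 3 \<and> - X p $ 3 / (p $ 3)^2 = a p / p $ 3 + b p * p $ 2
      \<and> X p $ 1 / p $ 1 * Y111 (p $ 1) / p $ 3 = b p * p $ 3
      \<and> X p $ 2 - 18 * p $ 3 * X p $ 1 = c p / p $ 3 + d p * p $ 2
      \<and> X p $ 3 + X p $ 1 / p $ 1 * Y111 (p $ 1) * p $ 2 = d p * p $ 3)"
  unfolding conn_matrix_def
  by (intro ball_cong refl)
     (simp add: forall_3 gm_conn_omega_t T_nz sum_3 vec_eq_iff omega_t_def S_mat_def divide_inverse)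

text \<open>The zero first row kills the \<open>z\<close>-coefficient; the (2,2) and (3,2) equations
  fix the other two, and the (3,3) equation agrees because the trace is 0.\<close>

lemma is_R_iff: "is_R T (lie_mat a b) X \<longleftrightarrow> X = comb 0 a b"
proof -
  have "conn_matrix T X (\<lambda>_. lie_mat a b) \<longleftrightarrow> (\<forall>p\<in>T. X p = comb 0 a b p)"
    unfolding lie_mat_def conn_matrix_iff
  proof (intro ball_cong refl)
    fix p assume "p \<in> T"
    then show "X p $ 1 / p $ 1 = 0 / p $ 3 \<and> - X p $ 3 / (p $ 3)^2 = - a / p $ 3 + 0 * p $ 2
      \<and> X p $ 1 / p $ 1 * Y111 (p $ 1) / p $ 3 = 0 * p $ 3
      \<and> X p $ 2 - 18 * p $ 3 * X p $ 1 = b / p $ 3 + a * p $ 2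
      \<and> X p $ 3 + X p $ 1 / p $ 1 * Y111 (p $ 1) * p $ 2 = a * p $ 3 \<longleftrightarrow> X p = comb 0 a b p"
      using T_nz[of p]
      by (auto simp: comb_eq on_T_def vec_eq_iff forall_3 power2_eq_square)
  qed
  then show ?thesis
    unfolding is_R_def using vf_eqI comb_vector_field by metis
qed

text \<open>The second row and the (3,2) entry determine \<open>X\<close> without mention of
  \<open>Y\<close>; the (1,2) equation then determines \<open>Y\<close>.\<close>

lemma is_modular_iff: "is_modular T X \<longleftrightarrow> X = R_modular T"
proof
  assume "is_modular T X"
  then obtain Y where X: "X \<in> vector_fields T"
    and c: "conn_matrix T X (\<lambda>p. vector [vector [0, inverse (Y p), 0], vector [0, 0, 1], vector [0, 0, 0]])"
    unfolding is_modular_def by blast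
  show "X = R_modular T"
  proof (rule vf_eqI[OF X basis_vector_fields(1)])
    fix p assume p: "p \<in> T"
    note nz = T_nz[OF p]
    have e: "- X p $ 3 / (p $ 3)^2 = p $ 2" "X p $ 1 / p $ 1 * Y111 (p $ 1) / p $ 3 = p $ 3"
        "X p $ 2 - 18 * p $ 3 * X p $ 1 = 0"
      using c[unfolded conn_matrix_iff, rule_format, OF p, THEN conjunct2] by auto
    have Y: "Y111 (p $ 1) \<noteq> 0" using nz by (simp add: Y111_def)
    have X1: "X p $ 1 = p $ 1 * (p $ 3)^2 / Y111 (p $ 1)"
      using e(2) nz Y by (simp add: field_simps power2_eq_square)
    have X3: "X p $ 3 = - p $ 2 * (p $ 3)^2"
      using e(1) nz by (simp add: field_simps minus_equation_iff[of "X p $ 3"])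
    have X2: "X p $ 2 = 18 * p $ 1 * (p $ 3)^3 / Y111 (p $ 1)"
      using e(3) by (simp add: X1 power2_eq_square power3_eq_cube mult_ac)
    show "X p = R_modular T p"
      using p by (simp add: R_modular_def on_T_def Let_def vec_eq_iff forall_3 X1 X2 X3)
  qed
next
  assume X: "X = R_modular T"
  \<comment> \<open>Solved from the (1,2) equation, and set to 0 outside \<open>T\<close> to be a
    regular function.\<close>
  define Y where "Y = (\<lambda>p. if p \<in> T then Y111 (p $ 1) / (p $ 3)^3 else 0)"
  have "Y \<in> regular_functions T"
    by (rule regular_functionsI[OF open_T, of "\<lambda>p. (- 1 / (3 * (1 - 27 * p$1))) / (p $ 3)^3"])
       (use T_nz in \<open>auto simp: Y_def Y111_def intro!: holomorphic_at_intros\<close>)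
  moreover have Y0: "\<forall>p\<in>T. Y111 (p $ 1) \<noteq> 0" using T_nz(2) by (simp add: Y111_def)
  then have "\<forall>p\<in>T. Y p \<noteq> 0" using T_nz by (simp add: Y_def)
  moreover have "conn_matrix T X (\<lambda>p. vector [vector [0, inverse (Y p), 0], vector [0, 0, 1], vector [0, 0, 0]])"
    unfolding conn_matrix_iff using T_nz Y0
    by (auto simp: X Y_def R_modular_def on_T_def Let_def power2_eq_square power3_eq_cube)
  ultimately show "is_modular T X"
    unfolding is_modular_def using basis_vector_fields(1) X by blast
qed

section \<open>The module over the regular functions\<close>

lemma gm_generators_eq: "gm_generators T = insert (R_modular T) {comb 0 a b | a b. True}"
proof -
  have "{X. \<exists>g\<in>lie_G. is_R T g X} = {comb 0 a b | a b. True}"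
    unfolding lie_G_eq using is_R_iff by blast
  then show ?thesis by (simp add: gm_generators_def is_modular_iff)
qed

lemma basis_in_generators: "{R_modular T, R_g33 T, R_g32 T} \<subseteq> gm_generators T"
  unfolding gm_generators_eq comb_basis by blast

text \<open>In the coordinate order \<open>z\<close>, \<open>s33\<close>, \<open>s32\<close> the
  fields form a triangular matrix with diagonal \<open>-3 * z * (1 - 27 * z) * s33^2\<close>,
  \<open>s33\<close>, \<open>1 / s33\<close>. None of these vanishes on \<open>T\<close>, so back
  substitution gives holomorphic coefficients \<open>a\<close>, \<open>b\<close>,
  \<open>c\<close>.\<close>

lemma span_regular:
  "span_over (regular_functions T) {R_modular T, R_g33 T, R_g32 T} = vector_fields T"
proof -
  let ?K = "regular_functions T"
  have K0: "(\<lambda>_. 0) \<in> ?K"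
    by (auto simp: regular_functions_iff holomorphic_at_const)
  have Kadd: "(\<lambda>p. f p + g p) \<in> ?K" if "f \<in> ?K" "g \<in> ?K" for f g
    using that by (auto simp: regular_functions_iff holomorphic_at_add)
  have Kmult: "(\<lambda>p. f p * g p) \<in> ?K" if "f \<in> ?K" "g \<in> ?K" for f g
    using that by (auto simp: regular_functions_iff holomorphic_at_mult)
  have span: "X \<in> span_over ?K {R_modular T, R_g33 T, R_g32 T} \<longleftrightarrow> (\<exists>a\<in>?K. \<exists>b\<in>?K. \<exists>c\<in>?K.
      X = (\<lambda>p. a p *s R_modular T p + b p *s R_g33 T p + c p *s R_g32 T p))" for X
    by (subst span_over_three) (auto intro: K0 Kadd)
  show ?thesis
  proof (intro equalityI subsetI)
    fix X assume "X \<in> span_over ?K {R_modular T, R_g33 T, R_g32 T}"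
    then show "X \<in> vector_fields T"
      using basis_vector_fields unfolding span by (auto simp: vector_fields_def intro!: Kadd Kmult)
  next
    fix X assume "X \<in> vector_fields T"
    then have X: "\<And>p i. p \<in> T \<Longrightarrow> holomorphic_at (\<lambda>p. X p $ i) p"
      and X0: "\<And>p. p \<notin> T \<Longrightarrow> X p = 0"
      by (auto simp: vector_fields_def regular_functions_iff vec_eq_iff)
    define a where "a = (\<lambda>p. X p $ 1 / (-3 * p$1 * (1 - 27 * p$1) * (p$3)^2))"
    define b where "b = (\<lambda>p. (X p $ 3 + a p * p$2 * (p$3)^2) / p$3)"
    define c where "c = (\<lambda>p. p$3 * (X p $ 2 + 54 * a p * p$1 * (1 - 27 * p$1) * (p$3)^3 - b p * p$2))"
    have a: "holomorphic_at a p" if "p \<in> T" for p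
      unfolding a_def using T_nz[OF that] by (auto intro!: holomorphic_at_intros X that)
    have b: "holomorphic_at b p" if "p \<in> T" for p
      unfolding b_def using T_nz[OF that] by (auto intro!: holomorphic_at_intros X a that)
    have c: "holomorphic_at c p" if "p \<in> T" for p
      unfolding c_def using T_nz[OF that] by (auto intro!: holomorphic_at_intros X a b that)
    have restrict: "(\<lambda>p. if p \<in> T then f p else 0) \<in> ?K" if "\<And>p. p \<in> T \<Longrightarrow> holomorphic_at f p" for f
      by (rule regular_functionsI[OF open_T that]) auto
    have "X p = (if p \<in> T then a p else 0) *s R_modular T p + (if p \<in> T then b p else 0) *s R_g33 T p
        + (if p \<in> T then c p else 0) *s R_g32 T p" for p
    proof (cases "p \<in> T")
      case True
      note nz = T_nz[OF True]
      have "X p $ 1 = a p * (-3 * p$1 * (1 - 27 * p$1) * (p$3)^2)"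
        using nz by (simp add: a_def)
      moreover have "X p $ 3 = - a p * p$2 * (p$3)^2 + b p * p$3"
        using nz by (simp add: b_def)
      moreover have "X p $ 2 = - 54 * a p * p$1 * (1 - 27 * p$1) * (p$3)^3 + b p * p$2 + c p / p$3"
        using nz by (simp add: c_def)
      ultimately show ?thesis
        using True by (simp add: R_modular_eq R_g33_def R_g32_def on_T_def vec_eq_iff forall_3 Let_def)
    qed (simp add: X0)
    then show "X \<in> span_over ?K {R_modular T, R_g33 T, R_g32 T}"
      unfolding span
      by (intro bexI[OF _ restrict[OF a]] bexI[OF _ restrict[OF b]] bexI[OF _ restrict[OF c]] ext)
  qed
qed

text \<open>The generators are vector fields and include the three basis fields. Closure under the
  bracket thereby reduces to \<open>vf_bracket_vector_field\<close>.\<close>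

lemma gm_lie_algebra_eq: "gm_lie_algebra T = vector_fields T"
proof
  have "gm_generators T \<subseteq> vector_fields T"
    using basis_vector_fields comb_vector_field by (auto simp: gm_generators_eq)
  then show "gm_lie_algebra T \<subseteq> vector_fields T"
  proof (intro subsetI)
    fix X assume sub: "gm_generators T \<subseteq> vector_fields T" and "X \<in> gm_lie_algebra T"
    from this(2)[unfolded gm_lie_algebra_def] show "X \<in> vector_fields T"
    proof induction
      case zero
      show ?case by (auto simp: vector_fields_def regular_functions_iff holomorphic_at_const)
    next
      case (add f X Y)
      then show ?case
        using sub by (force simp: vector_fields_def regular_functions_iff
            intro!: holomorphic_at_add holomorphic_at_mult)
    qed
  qed
  show "vector_fields T \<subseteq> gm_lie_algebra T"
    unfolding gm_lie_algebra_def span_regular[symmetric]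
    using span_over_mono basis_in_generators by blast
qed

lemma basis_independent:
  assumes "a *s R_modular T p + b *s R_g33 T p + c *s R_g32 T p = 0" "p \<in> T"
  shows "a = 0" "b = 0" "c = 0"
  using assms T_nz[OF assms(2)]
  by (auto simp: R_modular_eq R_g33_def R_g32_def on_T_def vec_eq_iff forall_3 Let_def)

section \<open>Constant coefficients and the isomorphism with sl2\<close>

lemma comb_span_constants:
  "span_over constants {R_modular T, R_g33 T, R_g32 T} = {comb a b c | a b c. True}"
proof -
  have ex: "(\<exists>f\<in>constants. P f) \<longleftrightarrow> (\<exists>k. P (\<lambda>_. k))" for P
    by (auto simp: constants_def)
  show ?thesis
    by (subst span_over_three) (auto simp: ex comb_def, auto simp: constants_def)
qed

lemma comb_add: "comb (a + a') (b + b') (c + c') = (\<lambda>p. comb a b c p + comb a' b' c' p)"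
  and comb_scale: "comb (k * a) (k * b) (k * c) = (\<lambda>p. k *s comb a b c p)"
  by (simp_all add: comb_def fun_eq_iff vec_eq_iff algebra_simps)

lemma span_constants:
  "span_over constants (gm_generators T) = {comb a b c | a b c. True}"
proof
  show "{comb a b c | a b c. True} \<subseteq> span_over constants (gm_generators T)"
    unfolding comb_span_constants[symmetric]
    using span_over_mono basis_in_generators by blast
  show "span_over constants (gm_generators T) \<subseteq> {comb a b c | a b c. True}"
  proof
    fix X assume "X \<in> span_over constants (gm_generators T)"
    then show "X \<in> {comb a b c | a b c. True}"
    proof induction
      case zero
      have "(\<lambda>_. 0) = comb 0 0 0" by (simp add: comb_def)
      then show ?case by blast
    next
      case (add f X Y)
      from add obtain k a b c a' b' c' where
        "f = (\<lambda>_. k)" "X = comb a b c" "Y = comb a' b' c'"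
        by (auto simp: constants_def gm_generators_eq comb_basis)
      then have "(\<lambda>p. f p *s X p + Y p) = comb (k * a + a') (k * b + b') (k * c + c')"
        by (simp add: comb_add comb_scale)
      then show ?case by blast
    qed
  qed
qed

text \<open>Evaluation at one point of \<open>T\<close> suffices, as the fields are independent
  pointwise.\<close>

lemma comb_inj: "comb a b c = comb a' b' c' \<Longrightarrow> a = a' \<and> b = b' \<and> c = c'"
proof -
  assume eq: "comb a b c = comb a' b' c'"
  obtain p where p: "p \<in> T" using nonempty_T by blast
  have "(a - a') *s R_modular T p + (b - b') *s R_g33 T p + (c - c') *s R_g32 T p = 0"
    using fun_cong[OF eq, of p] by (simp add: comb_def vec_eq_iff algebra_simps)
  from basis_independent[OF this p] show ?thesis by auto
qed

text \<open>The factor \<open>1 - 54 * z\<close> is the derivative of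
  \<open>z * (1 - 27 * z)\<close>.\<close>

lemma has_gradient_comb:
  assumes p: "p \<in> T"
  shows
   "has_gradient (\<lambda>q. comb a b c q $ 1)
      (vector [-3 * a * (1 - 54 * p$1) * (p$3)^2, 0, -6 * a * p$1 * (1 - 27 * p$1) * p$3]) p" (is ?t1)
   "has_gradient (\<lambda>q. comb a b c q $ 2)
      (vector [-54 * a * (1 - 54 * p$1) * (p$3)^3, b,
        -162 * a * p$1 * (1 - 27 * p$1) * (p$3)^2 - c * inverse (p$3) * inverse (p$3)]) p" (is ?t2)
   "has_gradient (\<lambda>q. comb a b c q $ 3)
      (vector [0, - a * (p$3)^2, - 2 * a * p$2 * p$3 + b]) p" (is ?t3)
proof -
  note nz = T_nz[OF p]
  note [derivative_intros] = bounded_linear.has_derivative[OF bounded_linear_vec_nth]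
  have "has_gradient (\<lambda>p. -3 * a * p$1 * (1 - 27 * p$1) * (p$3)^2)
      (vector [-3 * a * (1 - 54 * p$1) * (p$3)^2, 0, -6 * a * p$1 * (1 - 27 * p$1) * p$3]) p"
    unfolding has_gradient_def
    by (auto intro!: derivative_eq_intros simp: sum_3 fun_eq_iff algebra_simps power2_eq_square)
  then show ?t1
    by (rule has_gradient_transform[OF _ open_T p]) (simp add: comb_eq on_T_def)
  have "has_gradient (\<lambda>p. -54 * a * p$1 * (1 - 27 * p$1) * (p$3)^3 + b * p$2 + c * inverse (p$3))
      (vector [-54 * a * (1 - 54 * p$1) * (p$3)^3, b,
        -162 * a * p$1 * (1 - 27 * p$1) * (p$3)^2 - c * inverse (p$3) * inverse (p$3)]) p"
    unfolding has_gradient_def using nz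
    by (auto intro!: derivative_eq_intros simp: sum_3 fun_eq_iff algebra_simps power2_eq_square power3_eq_cube)
  then show ?t2
    by (rule has_gradient_transform[OF _ open_T p]) (simp add: comb_eq on_T_def divide_inverse)
  have "has_gradient (\<lambda>p. - a * p$2 * (p$3)^2 + b * p$3)
      (vector [0, - a * (p$3)^2, - 2 * a * p$2 * p$3 + b]) p"
    unfolding has_gradient_def
    by (auto intro!: derivative_eq_intros simp: sum_3 fun_eq_iff algebra_simps power2_eq_square)
  then show ?t3
    by (rule has_gradient_transform[OF _ open_T p]) (simp add: comb_eq on_T_def)
qed

text \<open>The right side is the commutator of the trace-zero matrices with rows
  \<open>(b, a)\<close>, \<open>(c, -b)\<close> and \<open>(b', a')\<close>,
  \<open>(c', -b')\<close>, read off entrywise.\<close>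

lemma bracket_comb:
  "vf_bracket T (comb a b c) (comb a' b' c') =
   comb (2 * (b * a' - a * b')) (a * c' - c * a') (2 * (c * b' - b * c'))"
proof (rule vf_eqI[OF vf_bracket_vector_field[OF open_T] comb_vector_field])
  fix p assume p: "p \<in> T"
  note nz = T_nz[OF p]
  note g = has_gradient_comb[OF p, THEN vf_apply_eq]
  show "vf_bracket T (comb a b c) (comb a' b' c') p =
   comb (2 * (b * a' - a * b')) (a * c' - c * a') (2 * (c * b' - b * c')) p"
    using p nz
    \<comment> \<open>\<open>comb\<close> stays folded in the first pass so that the gradient rules
      apply; the second compares explicit coefficients.\<close>
    by (simp add: vf_bracket_def on_T_def vec_eq_iff forall_3 g sum_3)
       (simp add: comb_eq on_T_def field_simps power2_eq_square power3_eq_cube)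
qed (rule comb_vector_field)+

text \<open>The standard basis e, h, f of sl2 goes to \<open>R_modular T\<close>,
  \<open>R_g33 T\<close>, \<open>R_g32 T\<close>; trace zero makes the entries (1,2), (1,1), (2,1)
  coordinates on \<open>sl2\<close>.\<close>

lemma sl2_iso_comb:
  "sl2_iso T (\<lambda>A. comb (A$1$2) (A$1$1) (A$2$1)) {comb a b c | a b c. True}"
  unfolding sl2_iso_def
proof (intro conjI ballI allI)
  have tr: "A \<in> sl2 \<longleftrightarrow> A$2$2 = - A$1$1" for A
    by (simp add: sl2_def trace_def sum_2 add_eq_0_iff)
  show "bij_betw (\<lambda>A. comb (A$1$2) (A$1$1) (A$2$1)) sl2 {comb a b c | a b c. True}"
  proof (rule bij_betw_imageI)
    show "inj_on (\<lambda>A. comb (A$1$2) (A$1$1) (A$2$1)) sl2"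
      by (auto simp: inj_on_def tr vec_eq_iff forall_2 dest!: comb_inj)
    have "comb a b c \<in> (\<lambda>A. comb (A$1$2) (A$1$1) (A$2$1)) ` sl2" for a b c
      by (rule image_eqI[of _ _ "vector [vector [b, a], vector [c, - b]]"]) (simp_all add: tr)
    then show "(\<lambda>A. comb (A$1$2) (A$1$1) (A$2$1)) ` sl2 = {comb a b c | a b c. True}" by auto
  qed
  fix A B :: "complex^2^2" assume A: "A \<in> sl2" and B: "B \<in> sl2"
  show "comb ((A ** B - B ** A)$1$2) ((A ** B - B ** A)$1$1) ((A ** B - B ** A)$2$1)
      = vf_bracket T (comb (A$1$2) (A$1$1) (A$2$1)) (comb (B$1$2) (B$1$1) (B$2$1))"
    using A B by (simp add: bracket_comb matrix_matrix_mult_def sum_2 tr algebra_simps)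
qed (simp_all add: comb_add comb_scale)

end

section \<open>The moduli space and the final statement\<close>

lemma continuous_on_S_mat: "continuous_on {p. p $ 3 \<noteq> 0} S_mat"
proof -
  have "continuous_on {p. p $ 3 \<noteq> 0} (\<lambda>p. \<chi> i j. S_mat p $ i $ j)"
  proof (intro continuous_on_vec_lambda)
    fix i j :: 3
    show "continuous_on {p. p $ 3 \<noteq> 0} (\<lambda>p. S_mat p $ i $ j)"
      using exhaust_3[of i] exhaust_3[of j]
      by (elim disjE; simp add: S_mat_def) (auto intro!: continuous_intros)
  qed
  then show ?thesis by simp
qed

text \<open>Openness comes from pulling back the relatively open \<open>V\<close> along
  \<open>S_mat\<close>, which is continuous where \<open>s33\<close> is nonzero. The point with
  \<open>s32 = 0\<close> and \<open>s33 = 1\<close> lies over the identity and shows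
  nonemptiness.\<close>

lemma moduli_moduli_T:
  assumes "open U" "U \<noteq> {}" "U \<subseteq> - {0, 1/27}"
    and "openin (top_of_set group_G) V" "mat 1 \<in> V"
  shows "moduli (moduli_T U V)"
proof
  have G: "S_mat \<in> {p. p $ 3 \<noteq> 0} \<rightarrow> group_G" by (auto simp: group_G_def)
  have open3: "open {p::complex^3. p $ 3 \<noteq> 0}"
    by (intro open_Collect_neq continuous_intros)
  have "openin (top_of_set {p. p $ 3 \<noteq> 0}) ({p. p $ 3 \<noteq> 0} \<inter> S_mat -` V)"
    by (rule continuous_openin_preimage[OF continuous_on_S_mat G assms(4)])
  then have "open ({p. p $ 3 \<noteq> 0} \<inter> S_mat -` V)"
    using open3 openin_open_eq by blast
  moreover have "open {p::complex^3. p $ 1 \<in> U}"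
    using open_vimage_vec_nth[OF assms(1)] by (simp add: vimage_def)
  moreover have "moduli_T U V = {p. p $ 1 \<in> U} \<inter> ({p. p $ 3 \<noteq> 0} \<inter> S_mat -` V)"
    by (auto simp: moduli_T_def)
  ultimately show "open (moduli_T U V)" by auto
  obtain u where "u \<in> U" using assms(2) by blast
  moreover have "S_mat (vector [u, 0, 1]) = mat 1"
    by (simp add: S_mat_def mat_def vec_eq_iff forall_3)
  ultimately have "vector [u, 0, 1] \<in> moduli_T U V"
    using assms(5) by (simp add: moduli_T_def)
  then show "moduli_T U V \<noteq> {}" by blast
  fix p assume "p \<in> moduli_T U V"
  then have "p $ 1 \<notin> {0, 1/27}" "p $ 3 \<noteq> 0"
    using assms(3) by (auto simp: moduli_T_def)
  then show "p $ 1 \<noteq> 0" "1 - 27 * p $ 1 \<noteq> 0" "p $ 3 \<noteq> 0"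
    by (auto simp: field_simps)
qed

text \<open>Over the regular functions the algebra is free of rank three; the isomorphism with
  \<open>sl2\<close> concerns the span of the same generators over the constants.\<close>

theorem theorem3:
  fixes U :: "complex set" and V :: "(complex^3^3) set" and T :: "(complex^3) set"
  assumes "open U" and "U \<noteq> {}" and "U \<subseteq> - {0, 1/27}"
    and "openin (top_of_set group_G) V" and "mat 1 \<in> V"
    and "T = moduli_T U V"
  shows "{X. is_modular T X} = {R_modular T}
    \<and> (\<forall>g\<in>lie_G. \<exists>!X. is_R T g X)
    \<and> g33 \<in> lie_G \<and> {X. is_R T g33 X} = {R_g33 T}
    \<and> g32 \<in> lie_G \<and> {X. is_R T g32 X} = {R_g32 T}
    \<and> gm_lie_algebra T \<subseteq> vector_fields T
    \<and> (\<forall>X\<in>gm_lie_algebra T. \<forall>Y\<in>gm_lie_algebra T. vf_bracket T X Y \<in> gm_lie_algebra T)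
    \<and> gm_lie_algebra T = span_over (regular_functions T) {R_modular T, R_g33 T, R_g32 T}
    \<and> (\<forall>f\<in>regular_functions T. \<forall>g\<in>regular_functions T. \<forall>h\<in>regular_functions T.
         (\<lambda>p. f p *s R_modular T p + g p *s R_g33 T p + h p *s R_g32 T p) = (\<lambda>_. 0)
           \<longrightarrow> f = (\<lambda>_. 0) \<and> g = (\<lambda>_. 0) \<and> h = (\<lambda>_. 0))
    \<and> span_over constants (gm_generators T) = span_over constants {R_modular T, R_g33 T, R_g32 T}
    \<and> (\<exists>\<phi>. sl2_iso T \<phi> (span_over constants (gm_generators T)))"
proof -
  interpret moduli T
    unfolding assms(6) by (rule moduli_moduli_T[OF assms(1-5)])
  have indep: "f = (\<lambda>_. 0) \<and> g = (\<lambda>_. 0) \<and> h = (\<lambda>_. 0)"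
    if r: "f \<in> regular_functions T" "g \<in> regular_functions T" "h \<in> regular_functions T"
      and eq: "(\<lambda>p. f p *s R_modular T p + g p *s R_g33 T p + h p *s R_g32 T p) = (\<lambda>_. 0)" for f g h
  proof -
    \<comment> \<open>On \<open>T\<close> this is pointwise independence; off \<open>T\<close>
      regular functions are 0 by convention.\<close>
    have "f p = 0 \<and> g p = 0 \<and> h p = 0" for p
      using r basis_independent[OF fun_cong[OF eq, of p]]
      by (cases "p \<in> T") (auto simp: regular_functions_iff)
    then show ?thesis by blast
  qed
  show ?thesis
    unfolding g33_eq g32_eq is_modular_iff is_R_iff gm_lie_algebra_eq span_regular span_constants
      comb_span_constants
  proof (intro conjI ballI impI)
    fix f g h
    assume "f \<in> regular_functions T" "g \<in> regular_functions T" "h \<in> regular_functions T"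
      and "(\<lambda>p. f p *s R_modular T p + g p *s R_g33 T p + h p *s R_g32 T p) = (\<lambda>_. 0)"
    from indep[OF this] show "f = (\<lambda>_. 0)" "g = (\<lambda>_. 0)" "h = (\<lambda>_. 0)" by blast+
  qed (use vf_bracket_vector_field[OF open_T] sl2_iso_comb in
      \<open>auto simp: lie_G_eq is_R_iff comb_basis[symmetric]\<close>)
qed

end
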